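(* With $$R(s,t,\ell,u,v,w):=\sum_{n\ge 0}q^{s\binom{n}{2}+tn}\,r(\ell,u,v,w;n),\qquad r(\ell,u,v,w;n):=\sum_{j\ge 0}\frac{(-1)^j\,q^{uv\frac{j(j-1)}{2}+(w-u\ell)j}}{(q;q)_{n-uj}\,(q^{uv};q^{uv})_j},$$ the following identities hold: $$R(2,1,1,1,2,2)=(-q;q^2)_\infty,$$ $$R(2,2,1,1,2,2)=(-q^2;q^2)_\infty,$$ and, for every positive integer $m$, $$R(m,m,1,1,1,2)=\frac{(q^{2m};q^{2m})_\infty}{(q^m;q^{2m})_\infty}.$$
   Context: Here $(a;q)_\infty=\prod_{k\ge 0}(1-aq^k)$ and $(a;q)_n=(a;q)_\infty/(aq^n;q)_\infty$ for $n\in\mathbb{Z}$, so that $(a;q)_n=\prod_{k=0}^{n-1}(1-aq^k)$ for $n\ge 0$. By convention $\frac{1}{(q;q)_n}=0$ for $n<0$, so the sum defining $r(\ell,u,v,w;n)$ is finite when $u\geq 1$. The identities may be read as identities of formal power series in $q$, or of convergent series and products for complex $q$ with $|q|<1$. *)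

theory Defs
  imports "HOL-Analysis.Analysis"
begin

definition qpoch_inf :: "complex \<Rightarrow> complex \<Rightarrow> complex" where
  "qpoch_inf a q = (\<Prod>k. 1 - a * q ^ k)"

definition qpoch :: "complex \<Rightarrow> complex \<Rightarrow> int \<Rightarrow> complex" where
  "qpoch a q n = qpoch_inf a q / qpoch_inf (a * q powi n) q"

(* For n < 0 the denominator of qpoch q q n is the vanishing product (q^(n+1); q)_inf
   (if q is nonzero), so 1 / (q; q)_n is fixed by convention rather than by division. *)
definition inv_qfact :: "complex \<Rightarrow> int \<Rightarrow> complex" where
  "inv_qfact q n = (if n < 0 then 0 else 1 / qpoch q q n)"

(* The exponents are integers because w - u * l may be negative.  For u >= 1 only the
   terms with u * j <= n are nonzero, so the series is a finite sum. *)
definition r :: "complex \<Rightarrow> int \<Rightarrow> int \<Rightarrow> int \<Rightarrow> int \<Rightarrow> nat \<Rightarrow> complex" where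
  "r q l u v w n =
     (\<Sum>j. (-1) ^ j * q powi (u * v * int (j * (j - 1) div 2) + (w - u * l) * int j)
            * inv_qfact q (int n - u * int j)
            / qpoch (q powi (u * v)) (q powi (u * v)) (int j))"

definition R_term ::
    "complex \<Rightarrow> int \<Rightarrow> int \<Rightarrow> int \<Rightarrow> int \<Rightarrow> int \<Rightarrow> int \<Rightarrow> nat \<Rightarrow> complex" where
  "R_term q s t l u v w n = q powi (s * int (n choose 2) + t * int n) * r q l u v w n"

definition R :: "complex \<Rightarrow> int \<Rightarrow> int \<Rightarrow> int \<Rightarrow> int \<Rightarrow> int \<Rightarrow> int \<Rightarrow> complex" where
  "R q s t l u v w = (\<Sum>n. R_term q s t l u v w n)"

lemma convergent_prod_qpoch_inf:
  assumes "norm q < 1"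
  shows "convergent_prod (\<lambda>k. 1 - a * q ^ k :: complex)"
proof -
  have "summable (\<lambda>k. norm (a * q ^ k))"
    using assms by (simp add: norm_mult norm_power summable_mult summable_geometric)
  then show ?thesis
    by (intro abs_convergent_prod_imp_convergent_prod summable_imp_abs_convergent_prod) simp
qed

lemma qpoch_of_nat:
  assumes q: "norm q < 1" and nz: "\<And>k. a * q ^ k \<noteq> 1"
  shows "qpoch a q (int n) = (\<Prod>k<n. 1 - a * q ^ k)"
proof -
  have 1: "qpoch_inf (a * q ^ n) q \<noteq> 0"
    unfolding qpoch_inf_def
    by (rule prodinf_nonzero[OF convergent_prod_qpoch_inf[OF q]])
       (use nz[of "n + _"] in \<open>simp add: power_add mult.assoc\<close>)
  have "qpoch_inf a q = qpoch_inf (a * q ^ n) q * (\<Prod>k<n. 1 - a * q ^ k)"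
    unfolding qpoch_inf_def
    using prodinf_split_initial_segment[OF convergent_prod_qpoch_inf[OF q, of a], of n] nz
    by (simp add: power_add mult_ac)
  with 1 show ?thesis
    by (simp add: qpoch_def)
qed

end

theory Submission
  imports Defs
begin

text \<open>
  Reading \<open>r\<close> as a Cauchy product, the generating function of \<open>r(1,1,v,2;n)\<close> is
  \<open>(qx;q^v)\<^sub>\<infinity> / (x;q)\<^sub>\<infinity>\<close>, which is \<open>1 / (x;q^2)\<^sub>\<infinity>\<close> for \<open>v = 2\<close> and \<open>1 / (1 - x)\<close> for \<open>v = 1\<close>.
  Hence \<open>r\<close> equals \<open>1 / (q^2;q^2)\<^sub>n\<close> and \<open>1\<close>, respectively. The first two identities become
  instances of Euler's expansion of \<open>(-z;Q)\<^sub>\<infinity>\<close>, the third one becomes Gauss' product for the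
  generating function of the triangular numbers, which is the limit of Shanks' finite identity.
\<close>

section \<open>Nonvanishing factors and finite q-factorials\<close>

lemma one_minus_power_nonzero:
  fixes q :: "'a :: real_normed_div_algebra"
  assumes "norm q < 1" "n > 0"
  shows "1 - q ^ n \<noteq> 0"
proof
  assume "1 - q ^ n = 0"
  hence "norm (q ^ n) = 1" by simp
  moreover have "norm q ^ n < 1"
    using assms by (simp add: power_less_one_iff)
  ultimately show False by (simp add: norm_power)
qed

definition qfact :: "complex \<Rightarrow> nat \<Rightarrow> complex" where
  "qfact q n = (\<Prod>k<n. 1 - q ^ Suc k)"

lemma qfact_0 [simp]: "qfact q 0 = 1"
  by (simp add: qfact_def)

lemma qfact_Suc: "qfact q (Suc n) = qfact q n * (1 - q ^ Suc n)"
  by (simp add: qfact_def)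

lemma qfact_nonzero: "norm q < 1 \<Longrightarrow> qfact q n \<noteq> 0"
  using one_minus_power_nonzero[of q "Suc _"] by (auto simp: qfact_def simp del: power_Suc)

lemma qpoch_self:
  assumes "norm q < 1"
  shows "qpoch q q (int n) = qfact q n"
  using qpoch_of_nat[of q q n] one_minus_power_nonzero[of q "Suc _"] assms
  by (auto simp: qfact_def)

lemma inv_qfact_of_nat: "norm q < 1 \<Longrightarrow> inv_qfact q (int n) = 1 / qfact q n"
  by (simp add: inv_qfact_def qpoch_self)

section \<open>Euler's expansions\<close>

definition euler_coeff :: "complex \<Rightarrow> complex \<Rightarrow> nat \<Rightarrow> complex" where
  "euler_coeff Q z n = Q ^ (n choose 2) * z ^ n / qfact Q n"

lemma euler_coeff_0 [simp]: "euler_coeff Q z 0 = 1"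
  by (simp add: euler_coeff_def numeral_2_eq_2)

lemma Suc_choose_two: "Suc n choose 2 = (n choose 2) + n"
  by (simp add: numeral_2_eq_2)

lemma euler_coeff_Suc:
  "euler_coeff Q z (Suc n) = euler_coeff Q z n * (Q ^ n * z / (1 - Q ^ Suc n))"
  by (simp add: euler_coeff_def Suc_choose_two qfact_Suc power_add mult_ac)

text \<open>Coefficient form of the functional equation \<open>f(z) = (1 + z) f(Q z)\<close>; it
  serves the convergent series as well as the formal one.\<close>

lemma euler_coeff_recurrence:
  assumes "norm Q < 1"
  shows "euler_coeff Q z (Suc n) = Q ^ Suc n * euler_coeff Q z (Suc n) + z * Q ^ n * euler_coeff Q z n"
proof -
  have "euler_coeff Q z (Suc n) * (1 - Q ^ Suc n) = z * Q ^ n * euler_coeff Q z n"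
    using one_minus_power_nonzero[OF assms, of "Suc n"] by (simp add: euler_coeff_Suc)
  thus ?thesis by (simp add: algebra_simps)
qed

lemma euler_coeff_scale: "euler_coeff Q (c * z) n = c ^ n * euler_coeff Q z n"
  by (simp add: euler_coeff_def power_mult_distrib)

text \<open>The ratio of consecutive terms tends to 0, because it carries the factor
  \<open>Q ^ n\<close>.\<close>

lemma summable_euler_coeff:
  assumes "norm Q < 1"
  shows "summable (euler_coeff Q z)"
proof -
  have "(\<lambda>n. Q ^ n * z / (1 - Q ^ Suc n)) \<longlonglongrightarrow> 0 * z / (1 - 0)"
    using assms LIMSEQ_Suc[OF LIMSEQ_power_zero[OF assms]]
    by (intro tendsto_intros LIMSEQ_power_zero) auto
  hence "eventually (\<lambda>n. norm (Q ^ n * z / (1 - Q ^ Suc n)) < 1/2) sequentially"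
    by (intro order_tendstoD(2)[OF tendsto_norm_zero]) auto
  then obtain N where N: "\<And>n. n \<ge> N \<Longrightarrow> norm (Q ^ n * z / (1 - Q ^ Suc n)) < 1/2"
    by (auto simp: eventually_sequentially)
  show ?thesis
  proof (rule summable_ratio_test[of "1/2" N])
    fix n assume "n \<ge> N"
    hence "norm (Q ^ n * z / (1 - Q ^ Suc n)) \<le> 1/2"
      using N less_imp_le by blast
    hence "norm (euler_coeff Q z n) * norm (Q ^ n * z / (1 - Q ^ Suc n))
             \<le> norm (euler_coeff Q z n) * (1/2)"
      by (intro mult_left_mono) auto
    thus "norm (euler_coeff Q z (Suc n)) \<le> 1/2 * norm (euler_coeff Q z n)"
      by (simp only: euler_coeff_Suc norm_mult mult.commute)
  qed simp
qed

text \<open>Iterating \<open>f(z) = (1 + z) f(Q z)\<close> splits off the first \<open>N\<close>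
  factors of the product; the remaining factor \<open>f(Q^N z)\<close> tends to
  \<open>f 0 = 1\<close> by continuity.\<close>

theorem euler_sum:
  assumes Q: "norm Q < 1"
  shows "(\<Sum>n. euler_coeff Q z n) = qpoch_inf (- z) Q"
proof -
  define f where "f z = (\<Sum>n. euler_coeff Q z n)" for z
  have f_eq: "f z = (\<Sum>n. euler_coeff Q 1 n * z ^ n)" for z
    unfolding f_def using euler_coeff_scale[of Q z 1] by (intro suminf_cong) (simp add: mult.commute)
  have step: "f z = (1 + z) * f (Q * z)" for z
  proof -
    note S = summable_euler_coeff[OF Q]
    have "f z = 1 + (\<Sum>n. euler_coeff Q z (Suc n))"
      using suminf_split_head[OF S] by (simp add: f_def)
    \<comment> \<open>The powers of \<open>Q\<close> in the recurrence are absorbed by passing from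
      \<open>z\<close> to \<open>Q * z\<close>.\<close>
    also have "(\<Sum>n. euler_coeff Q z (Suc n)) =
        (\<Sum>n. euler_coeff Q (Q * z) (Suc n) + z * euler_coeff Q (Q * z) n)"
      by (subst euler_coeff_recurrence[OF Q]) (simp add: euler_coeff_scale mult_ac)
    also have "\<dots> = (\<Sum>n. euler_coeff Q (Q * z) (Suc n)) + z * f (Q * z)"
      using S[of "Q * z"] unfolding f_def
      by (subst suminf_add[symmetric]) (auto simp: summable_Suc_iff suminf_mult summable_mult)
    also have "(\<Sum>n. euler_coeff Q (Q * z) (Suc n)) = f (Q * z) - 1"
      using suminf_split_head[OF S] by (simp add: f_def)
    finally show ?thesis by (simp add: algebra_simps)
  qed
  have iter: "f z = (\<Prod>k<N. 1 - (- z) * Q ^ k) * f (Q ^ N * z)" for N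
    by (induction N) (use step[of "Q ^ _ * z"] in \<open>auto simp: mult_ac\<close>)
  \<comment> \<open>Convergence of the power series at 1 gives continuity inside the unit
    disc.\<close>
  have "isCont f 0"
    unfolding f_eq
    by (rule isCont_powser[of _ 1])
       (use summable_euler_coeff[OF Q, of 1] in auto)
  moreover have "(\<lambda>N. Q ^ N * z) \<longlonglongrightarrow> 0"
    using LIMSEQ_power_zero[OF Q] tendsto_mult_left_zero by blast
  ultimately have "(\<lambda>N. f (Q ^ N * z)) \<longlonglongrightarrow> f 0"
    by (rule isCont_tendsto_compose)
  moreover have "f 0 = 1"
    unfolding f_eq by (subst powser_zero) simp
  moreover have "(\<lambda>N. \<Prod>k<N. 1 - (- z) * Q ^ k) \<longlonglongrightarrow> qpoch_inf (- z) Q"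
    using convergent_prod_LIMSEQ[OF convergent_prod_qpoch_inf[OF Q, of "- z"]]
    unfolding qpoch_inf_def by (subst (asm) LIMSEQ_lessThan_iff_atMost[symmetric]) auto
  ultimately have "(\<lambda>N. (\<Prod>k<N. 1 - (- z) * Q ^ k) * f (Q ^ N * z)) \<longlonglongrightarrow> qpoch_inf (- z) Q * 1"
    by (intro tendsto_mult) simp_all
  hence "(\<lambda>N. f z) \<longlonglongrightarrow> qpoch_inf (- z) Q"
    by (simp only: iter[symmetric] mult_1_right)
  hence "f z = qpoch_inf (- z) Q"
    by (rule LIMSEQ_unique[OF tendsto_const])
  thus ?thesis by (simp only: f_def)
qed

section \<open>The coefficients $r$\<close>

definition dilate :: "'a :: comm_ring_1 \<Rightarrow> 'a fps \<Rightarrow> 'a fps" where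
  "dilate c f = Abs_fps (\<lambda>n. c ^ n * fps_nth f n)"

lemma dilate_nth [simp]: "fps_nth (dilate c f) n = c ^ n * fps_nth f n"
  by (simp add: dilate_def)

lemma dilate_mult: "dilate c (f * g) = dilate c f * dilate c g"
proof (rule fps_ext)
  fix n
  have "c ^ n * (fps_nth f i * fps_nth g (n - i)) =
          (c ^ i * fps_nth f i) * (c ^ (n - i) * fps_nth g (n - i))" if "i \<le> n" for i
  proof -
    have "c ^ n = c ^ i * c ^ (n - i)"
      using that by (simp flip: power_add)
    thus ?thesis by (simp only: mult_ac)
  qed
  thus "fps_nth (dilate c (f * g)) n = fps_nth (dilate c f * dilate c g) n"
    by (simp add: fps_mult_nth sum_distrib_left)
qed

lemma dilate_linear [simp]: "dilate c (1 - fps_const a * fps_X) = 1 - fps_const (a * c) * fps_X"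
  by (rule fps_ext) (auto simp: fps_X_def)

lemma dilate_dilate: "dilate c (dilate d f) = dilate (c * d) f"
  by (rule fps_ext) (simp add: power_mult_distrib mult_ac)

text \<open>Euler's expansion of \<open>1 / (x;q)_inf\<close>; the next series is that of
  \<open>(-z x;Q)_inf\<close>. Only their q-difference equations are used, so no infinite product of
  formal series has to be formed.\<close>

definition euler_fps1 :: "complex \<Rightarrow> complex fps" where
  "euler_fps1 q = Abs_fps (\<lambda>n. 1 / qfact q n)"

definition euler_fps2 :: "complex \<Rightarrow> complex \<Rightarrow> complex fps" where
  "euler_fps2 Q z = Abs_fps (euler_coeff Q z)"

text \<open>Formal counterpart of \<open>1 / (q x;q)_inf = (1 - x) / (x;q)_inf\<close>.\<close>

lemma dilate_euler_fps1:
  assumes "norm q < 1"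
  shows "dilate q (euler_fps1 q) = (1 - fps_X) * euler_fps1 q"
proof (rule fps_ext)
  fix n
  show "fps_nth (dilate q (euler_fps1 q)) n = fps_nth ((1 - fps_X) * euler_fps1 q) n"
    using qfact_nonzero[OF assms] one_minus_power_nonzero[OF assms, of n]
    by (cases n) (auto simp: euler_fps1_def left_diff_distrib qfact_Suc field_simps)
qed

text \<open>Formal counterpart of splitting the first factor off
  \<open>(-z x;Q)_inf\<close>.\<close>

lemma euler_fps2_eq:
  assumes "norm Q < 1"
  shows "euler_fps2 Q z = (1 + fps_const z * fps_X) * dilate Q (euler_fps2 Q z)"
proof (rule fps_ext)
  fix n
  show "fps_nth (euler_fps2 Q z) n = fps_nth ((1 + fps_const z * fps_X) * dilate Q (euler_fps2 Q z)) n"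
    using euler_coeff_recurrence[OF assms, of z "n - 1"]
    by (cases n) (auto simp: euler_fps2_def distrib_right mult.assoc)
qed

lemma choose_two_nat: "j * (j - 1) div 2 = j choose 2"
  by (simp add: choose_two)

text \<open>The sum over \<open>j\<close> is a convolution: \<open>(-1)^j q^j\<close> accounts for
  the argument \<open>- q\<close>, and the quadratic exponent for the base
  \<open>q ^ v\<close>.\<close>

lemma r_eq_fps_nth:
  assumes q: "norm q < 1" and v: "v > 0"
  shows "r q 1 1 (int v) 2 n = fps_nth (euler_fps1 q * euler_fps2 (q ^ v) (- q)) n"
proof -
  have qv: "norm (q ^ v) < 1"
    using q v by (simp add: norm_power power_less_one_iff)
  have e: "q powi (1 * int v * int (j * (j - 1) div 2) + (2 - 1 * 1) * int j)
             = (q ^ v) ^ (j choose 2) * q ^ j" for j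
  proof -
    have "1 * int v * int (j * (j - 1) div 2) + (2 - 1 * 1) * int j = int (v * (j choose 2) + j)"
      by (simp only: choose_two_nat) simp
    thus ?thesis
      by (simp only: power_int_of_nat power_add power_mult)
  qed
  have "r q 1 1 (int v) 2 n =
    (\<Sum>j\<le>n. (-1) ^ j * q powi (1 * int v * int (j * (j - 1) div 2) + (2 - 1 * 1) * int j)
            * inv_qfact q (int n - 1 * int j)
            / qpoch (q powi (1 * int v)) (q powi (1 * int v)) (int j))"
    \<comment> \<open>The convention in \<open>inv_qfact\<close> kills all terms with
      \<open>j > n\<close>.\<close>
    unfolding r_def by (rule suminf_finite) (auto simp: inv_qfact_def)
  also have "\<dots> = (\<Sum>j\<le>n. euler_coeff (q ^ v) (- q) j * (1 / qfact q (n - j)))"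
  proof (rule sum.cong)
    fix j assume "j \<in> {..n}"
    hence "int n - 1 * int j = int (n - j)" by auto
    hence 1: "inv_qfact q (int n - 1 * int j) = 1 / qfact q (n - j)"
      by (simp only: inv_qfact_of_nat[OF q])
    have 2: "qpoch (q powi (1 * int v)) (q powi (1 * int v)) (int j) = qfact (q ^ v) j"
      by (simp add: qpoch_self[OF qv])
    show "(-1) ^ j * q powi (1 * int v * int (j * (j - 1) div 2) + (2 - 1 * 1) * int j)
            * inv_qfact q (int n - 1 * int j)
            / qpoch (q powi (1 * int v)) (q powi (1 * int v)) (int j)
          = euler_coeff (q ^ v) (- q) j * (1 / qfact q (n - j))"
      unfolding 1 2 e euler_coeff_def power_minus[of q]
      by (simp only: times_divide_eq_right times_divide_eq_left divide_divide_eq_left mult_1_right mult_ac)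
  qed auto
  also have "\<dots> = fps_nth (euler_fps2 (q ^ v) (- q) * euler_fps1 q) n"
    by (simp add: fps_mult_nth euler_fps1_def euler_fps2_def atLeast0AtMost)
  finally show ?thesis by (simp add: mult.commute)
qed

text \<open>Replacing \<open>x\<close> by \<open>q^2 x\<close> is two q-steps for \<open>F\<close>
  and one for \<open>E\<close>. The factor \<open>1 - q x\<close> cancels, so \<open>F * E\<close>
  satisfies the equation of \<open>1 / (x;q^2)_inf\<close>, which determines its coefficients from
  the constant term 1.\<close>

lemma r_2_eq:
  assumes q: "norm q < 1"
  shows "r q 1 1 2 2 n = 1 / qfact (q ^ 2) n"
proof -
  define F where "F = euler_fps1 q"
  define E where "E = euler_fps2 (q ^ 2) (- q)"
  have q2: "norm (q ^ 2) < 1"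
    using q by (simp add: norm_power power_less_one_iff)
  have "dilate (q ^ 2) F = dilate q (dilate q F)"
    by (simp add: dilate_dilate power2_eq_square)
  also have "\<dots> = dilate q (1 - fps_const 1 * fps_X) * dilate q F"
    by (simp add: F_def dilate_euler_fps1[OF q] dilate_mult del: dilate_linear)
  also have "\<dots> = (1 - fps_const q * fps_X) * ((1 - fps_X) * F)"
    by (subst dilate_linear) (simp add: F_def dilate_euler_fps1[OF q])
  finally have F: "dilate (q ^ 2) F = (1 - fps_const q * fps_X) * ((1 - fps_X) * F)" .
  have E: "E = (1 - fps_const q * fps_X) * dilate (q ^ 2) E"
    using euler_fps2_eq[OF q2, of "- q"] by (simp add: E_def flip: fps_const_neg)
  have "dilate (q ^ 2) (F * E) = (1 - fps_X) * F * ((1 - fps_const q * fps_X) * dilate (q ^ 2) E)"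
    by (simp only: dilate_mult F mult_ac)
  also have "\<dots> = (1 - fps_X) * (F * E)"
    by (simp only: E[symmetric] mult.assoc)
  finally have FE: "dilate (q ^ 2) (F * E) = (1 - fps_X) * (F * E)" .
  have "fps_nth (F * E) n = 1 / qfact (q ^ 2) n"
  proof (induction n)
    case 0
    show ?case by (simp add: F_def E_def euler_fps1_def euler_fps2_def)
  next
    case (Suc n)
    have "(q ^ 2) ^ Suc n * fps_nth (F * E) (Suc n) = fps_nth (F * E) (Suc n) - fps_nth (F * E) n"
      by (simp only: FE dilate_nth[symmetric]) (simp add: left_diff_distrib)
    hence "fps_nth (F * E) n = fps_nth (F * E) (Suc n) * (1 - (q ^ 2) ^ Suc n)"
      by (simp only: right_diff_distrib mult.commute) simp
    hence "fps_nth (F * E) (Suc n) = fps_nth (F * E) n / (1 - (q ^ 2) ^ Suc n)"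
      using one_minus_power_nonzero[OF q2, of "Suc n"] by (simp only: zero_less_Suc) simp
    thus ?case
      by (simp only: Suc.IH qfact_Suc) simp
  qed
  thus ?thesis
    using r_eq_fps_nth[OF q, of 2 n] by (simp add: F_def E_def)
qed

text \<open>The series \<open>(1 - x) F E\<close> is invariant under replacing \<open>x\<close> by
  \<open>q x\<close>. As \<open>1 - q ^ Suc n\<close> is nonzero, it is constant, so all
  coefficients of \<open>F * E\<close> agree.\<close>

lemma r_1_eq:
  assumes q: "norm q < 1"
  shows "r q 1 1 1 2 n = 1"
proof -
  define F where "F = euler_fps1 q"
  define E where "E = euler_fps2 q (- q)"
  define G where "G = (1 - fps_X) * (F * E)"
  have E: "E = (1 - fps_const q * fps_X) * dilate q E"
    using euler_fps2_eq[OF q, of "- q"] by (simp add: E_def flip: fps_const_neg)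
  have "dilate q G = dilate q (1 - fps_const 1 * fps_X) * (dilate q F * dilate q E)"
    by (simp add: G_def dilate_mult del: dilate_linear)
  also have "\<dots> = (1 - fps_X) * F * ((1 - fps_const q * fps_X) * dilate q E)"
    by (subst dilate_linear) (simp add: F_def dilate_euler_fps1[OF q] mult_ac)
  also have "\<dots> = G"
    by (simp only: E[symmetric] mult.assoc G_def)
  finally have G: "dilate q G = G" .
  have "fps_nth G (Suc n) = 0" for n
    using arg_cong[OF G, of "\<lambda>f. fps_nth f (Suc n)"] one_minus_power_nonzero[OF q, of "Suc n"]
    by (auto simp: algebra_simps)
  hence step: "fps_nth (F * E) (Suc n) = fps_nth (F * E) n" for n
    by (simp add: G_def left_diff_distrib)
  have "fps_nth (F * E) n = 1"
    by (induction n)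
       (simp_all only: step, simp add: F_def E_def euler_fps1_def euler_fps2_def)
  thus ?thesis
    using r_eq_fps_nth[OF q, of 1 n] by (simp add: F_def E_def)
qed

section \<open>Gauss' triangular number identity\<close>

text \<open>The quotient \<open>(x^2;x^2)_n / (x;x^2)_n\<close>, a truncation of Gauss'
  product.\<close>

definition gauss_prod :: "'a :: field \<Rightarrow> nat \<Rightarrow> 'a" where
  "gauss_prod x n = (\<Prod>k<n. (1 - x ^ (2 * k + 2)) / (1 - x ^ (2 * k + 1)))"

lemma gauss_prod_Suc:
  "gauss_prod x (Suc n) = gauss_prod x n * ((1 - x ^ (2 * n + 2)) / (1 - x ^ (2 * n + 1)))"
  by (simp add: gauss_prod_def)

text \<open>When \<open>n\<close> grows by one, the changes of the old summands telescope. What is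
  left at the boundary, together with the new summand \<open>s = n\<close>, gives the two new
  triangular powers.\<close>

lemma shanks_identity:
  fixes x :: "'a :: field"
  assumes nz: "\<And>n. n > 0 \<Longrightarrow> 1 - x ^ n \<noteq> 0"
  shows "(\<Sum>s<2*n. x ^ (Suc s choose 2)) =
           (\<Sum>s<n. gauss_prod x n / gauss_prod x s * x ^ (s * (2 * n + 1)))"
proof (induction n)
  case (Suc n)
  define P where "P = gauss_prod x"
  have P: "P s \<noteq> 0" for s
    using nz by (auto simp: P_def gauss_prod_def simp del: power_Suc)
  \<comment> \<open>The telescoping certificate: its difference in \<open>s\<close> is the change of
    the \<open>s\<close>-th summand, and the factor \<open>1 - x ^ (2 * s)\<close> makes it vanish
    at 0.\<close>
  define T where "T s = P n / P s * x ^ (s * (2 * n + 1)) * (1 - x ^ (2 * s)) / (1 - x ^ (2 * n + 1))" for s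
  have D: "1 - x ^ (2 * n + 1) \<noteq> 0" by (rule nz) simp
  have telescope: "P (Suc n) / P s * x ^ (s * (2 * Suc n + 1)) =
               P n / P s * x ^ (s * (2 * n + 1)) + (T (Suc s) - T s)" for s
  proof -
    define a where "a = P n / P s * x ^ (s * (2 * n + 1))"
    define y where "y = x ^ (2 * s)"
    define z where "z = x ^ (2 * n + 1)"
    have nzs: "1 - x * y \<noteq> 0" "1 - x * x * y \<noteq> 0"
      using nz[of "2 * s + 1"] nz[of "2 * s + 2"] by (auto simp: y_def mult_ac)
    have PS: "P (Suc s) = P s * ((1 - x * x * y) / (1 - x * y))"
      by (simp add: P_def gauss_prod_Suc y_def mult_ac)
    have "T (Suc s) = a * z * (1 - x * y) / (1 - z)"
    proof -
      have "x ^ (Suc s * (2 * n + 1)) = x ^ (s * (2 * n + 1)) * z"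
        by (simp add: z_def algebra_simps flip: power_add)
      moreover have "x ^ (2 * Suc s) = x * x * y"
        by (simp add: y_def)
      ultimately have "T (Suc s) = P n / (P s * ((1 - x * x * y) / (1 - x * y))) *
            (x ^ (s * (2 * n + 1)) * z) * (1 - x * x * y) / (1 - z)"
        by (simp only: T_def z_def[symmetric] PS)
      thus ?thesis using nzs by (simp add: a_def)
    qed
    moreover have "T s = a * (1 - y) / (1 - z)"
      by (simp add: T_def a_def y_def z_def)
    moreover have "P (Suc n) / P s * x ^ (s * (2 * Suc n + 1)) = a * y * (1 - x * z) / (1 - z)"
    proof -
      have "x ^ (s * (2 * Suc n + 1)) = x ^ (s * (2 * n + 1)) * y"
        by (simp add: y_def algebra_simps flip: power_add)
      thus ?thesis
        by (simp only: P_def gauss_prod_Suc a_def z_def) (simp add: mult_ac)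
    qed
    \<comment> \<open>All powers are now hidden in \<open>a\<close>, \<open>y\<close> and
      \<open>z\<close>, so a rational identity remains.\<close>
    moreover have "a * y * (1 - x * z) / (1 - z)
                     = a + (a * z * (1 - x * y) / (1 - z) - a * (1 - y) / (1 - z))"
    proof -
      have "a * y * (1 - x * z) / (1 - z)
              = (a * (1 - z) + (a * z * (1 - x * y) - a * (1 - y))) / (1 - z)"
        by (simp add: algebra_simps)
      thus ?thesis
        using nonzero_mult_div_cancel_right[OF D, of a] unfolding z_def[symmetric]
        by (simp only: add_divide_distrib diff_divide_distrib)
    qed
    ultimately show ?thesis
      by (simp only: a_def)
  qed
  have "(\<Sum>s<Suc n. P (Suc n) / P s * x ^ (s * (2 * Suc n + 1)))
          = (\<Sum>s<n. P n / P s * x ^ (s * (2 * n + 1)) + (T (Suc s) - T s))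
              + P (Suc n) / P n * x ^ (n * (2 * Suc n + 1))"
    by (simp only: sum.lessThan_Suc telescope)
  also have "(\<Sum>s<n. P n / P s * x ^ (s * (2 * n + 1)) + (T (Suc s) - T s))
          = (\<Sum>s<2*n. x ^ (Suc s choose 2)) + (T n - T 0)"
    by (simp only: sum.distrib sum_lessThan_telescope Suc.IH P_def)
  also have "T 0 = 0" by (simp add: T_def)
  also have "(\<Sum>s<2*n. x ^ (Suc s choose 2)) + (T n - 0) + P (Suc n) / P n * x ^ (n * (2 * Suc n + 1))
     = (\<Sum>s<2*n. x ^ (Suc s choose 2)) + x ^ (Suc (2*n) choose 2) + x ^ (Suc (Suc (2*n)) choose 2)"
  proof -
    define b where "b = x ^ (n * (2 * n + 1))"
    define y where "y = x ^ (2 * n)"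
    have c: "Suc (2*n) choose 2 = n * (2 * n + 1)"
      by (simp add: choose_two)
    have 0: "n * (2 * Suc n + 1) = n * (2 * n + 1) + 2 * n"
      by (simp add: algebra_simps)
    have 1: "x ^ (Suc (2*n) choose 2) = b" by (simp only: c b_def)
    have 2: "x ^ (Suc (Suc (2*n)) choose 2) = b * (x * y)"
      by (simp only: Suc_choose_two[of "Suc (2*n)"] c power_add b_def y_def power_Suc)
    have 3: "x ^ (n * (2 * Suc n + 1)) = b * y"
      unfolding 0 power_add by (simp only: y_def b_def)
    have 4: "T n = b * (1 - y) / (1 - x * y)"
      using P[of n] by (simp add: T_def b_def y_def)
    have 5: "P (Suc n) / P n = (1 - x * x * y) / (1 - x * y)"
      using P[of n] by (simp add: P_def gauss_prod_Suc y_def mult_ac)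
    have 6: "1 - x * y \<noteq> 0" using D by (simp add: y_def)
    \<comment> \<open>The numerators add up to \<open>b * (1 - (x * y)^2)\<close>, a difference of
      squares that cancels the denominator.\<close>
    have "b * (1 - y) / (1 - x * y) + (1 - x * x * y) / (1 - x * y) * (b * y)
            = (b + b * (x * y)) * (1 - x * y) / (1 - x * y)"
      unfolding times_divide_eq_left add_divide_distrib[symmetric] by (simp add: algebra_simps)
    hence "b * (1 - y) / (1 - x * y) + (1 - x * x * y) / (1 - x * y) * (b * y) = b + b * (x * y)"
      by (simp only: nonzero_mult_div_cancel_right[OF 6])
    thus ?thesis unfolding 1 2 3 4 5 by (simp only: diff_0_right add.assoc)
  qed
  also have "\<dots> = (\<Sum>s<2 * Suc n. x ^ (Suc s choose 2))"
    by simp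
  finally show ?case by (simp only: P_def)
qed simp

text \<open>Numerator and denominator converge separately, and no factor of either limit vanishes.
  The nonzero limit later bounds the reciprocals of the truncations.\<close>

lemma gauss_prod_LIMSEQ:
  assumes x: "norm x < 1"
  shows "gauss_prod x \<longlonglongrightarrow> qpoch_inf (x ^ 2) (x ^ 2) / qpoch_inf x (x ^ 2)"
    and "qpoch_inf (x ^ 2) (x ^ 2) / qpoch_inf x (x ^ 2) \<noteq> 0"
proof -
  have x2: "norm (x ^ 2) < 1"
    using x by (simp add: norm_power power_less_one_iff)
  have lim: "(\<lambda>N. \<Prod>k<N. 1 - a * (x ^ 2) ^ k) \<longlonglongrightarrow> qpoch_inf a (x ^ 2)" for a
    using convergent_prod_LIMSEQ[OF convergent_prod_qpoch_inf[OF x2, of a]]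
    unfolding qpoch_inf_def by (subst (asm) LIMSEQ_lessThan_iff_atMost[symmetric]) auto
  have nz: "qpoch_inf (x ^ Suc i) (x ^ 2) \<noteq> 0" for i
    unfolding qpoch_inf_def
  proof (rule prodinf_nonzero[OF convergent_prod_qpoch_inf[OF x2]])
    fix k
    show "1 - x ^ Suc i * (x ^ 2) ^ k \<noteq> 0"
      using one_minus_power_nonzero[OF x, of "Suc i + 2 * k"]
      by (simp only: power_add power_mult) simp
  qed
  have "gauss_prod x = (\<lambda>N. (\<Prod>k<N. 1 - x ^ 2 * (x ^ 2) ^ k) / (\<Prod>k<N. 1 - x * (x ^ 2) ^ k))"
  proof
    fix N
    have "x ^ (2 * k + 2) = x ^ 2 * (x ^ 2) ^ k" "x ^ (2 * k + 1) = x * (x ^ 2) ^ k" for k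
      by (simp_all add: power_add power_mult power2_eq_square)
    thus "gauss_prod x N = (\<Prod>k<N. 1 - x ^ 2 * (x ^ 2) ^ k) / (\<Prod>k<N. 1 - x * (x ^ 2) ^ k)"
      by (simp only: gauss_prod_def prod_dividef)
  qed
  thus "gauss_prod x \<longlonglongrightarrow> qpoch_inf (x ^ 2) (x ^ 2) / qpoch_inf x (x ^ 2)"
    using nz[of 0] by (auto intro!: tendsto_divide lim)
  show "qpoch_inf (x ^ 2) (x ^ 2) / qpoch_inf x (x ^ 2) \<noteq> 0"
    using nz[of 0] nz[of 1] by (simp add: numeral_2_eq_2)
qed

text \<open>The exponent is at least \<open>n\<close>, so a geometric series dominates.\<close>

lemma summable_triangular:
  fixes x :: "'a :: {real_normed_div_algebra, banach}"
  assumes "norm x < 1"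
  shows "summable (\<lambda>n. x ^ (Suc n choose 2))"
proof (rule summable_comparison_test)
  show "\<exists>N. \<forall>n\<ge>N. norm (x ^ (Suc n choose 2)) \<le> norm x ^ n"
    using assms by (auto simp: norm_power Suc_choose_two intro!: power_decreasing)
qed (use assms in \<open>simp add: summable_geometric\<close>)

text \<open>In Shanks' identity the summand \<open>s = 0\<close> is the truncated product itself;
  the others are uniformly of size \<open>norm x ^ n\<close>, and there are fewer than
  \<open>n\<close> of them.\<close>

theorem gauss_triangular:
  assumes x: "norm x < 1"
  shows "(\<Sum>n. x ^ (Suc n choose 2)) = qpoch_inf (x ^ 2) (x ^ 2) / qpoch_inf x (x ^ 2)"
proof -
  define P where "P = gauss_prod x"
  define L where "L = qpoch_inf (x ^ 2) (x ^ 2) / qpoch_inf x (x ^ 2)"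
  have P: "P \<longlonglongrightarrow> L" and L: "L \<noteq> 0"
    using gauss_prod_LIMSEQ[OF x] by (simp_all add: P_def L_def)
  obtain A where A: "\<And>n. norm (P n) \<le> A"
    using convergent_imp_Bseq[OF convergentI[OF P]] by (auto simp: Bseq_def)
  obtain B where B: "\<And>n. norm (inverse (P n)) \<le> B"
    using convergent_imp_Bseq[OF convergentI[OF tendsto_inverse[OF P L]]] by (auto simp: Bseq_def)
  define err where "err n = (\<Sum>s=1..<n. P n / P s * x ^ (s * (2 * n + 1)))" for n
  have "norm (err n) \<le> A * B * (real n * norm x ^ n)" for n
  proof -
    have "norm (P n / P s * x ^ (s * (2 * n + 1))) \<le> A * B * norm x ^ n" if "s \<in> {1..<n}" for s
    proof -
      have "n \<le> 1 * (2 * n + 1)" by simp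
      also have "\<dots> \<le> s * (2 * n + 1)" using that by (intro mult_right_mono) auto
      finally have "norm x ^ (s * (2 * n + 1)) \<le> norm x ^ n"
        using x by (intro power_decreasing) auto
      moreover have "norm (P n) * norm (inverse (P s)) \<le> A * B"
        by (intro mult_mono A B order_trans[OF norm_ge_zero A] norm_ge_zero)
      ultimately have "norm (P n) * norm (inverse (P s)) * norm x ^ (s * (2 * n + 1)) \<le> A * B * norm x ^ n"
        using order_trans[OF norm_ge_zero A] order_trans[OF norm_ge_zero B]
        by (intro mult_mono[of "norm (P n) * norm (inverse (P s))" "A * B"]) auto
      thus ?thesis by (simp add: divide_inverse norm_mult norm_power)
    qed
    hence "norm (err n) \<le> (\<Sum>s=1..<n. A * B * norm x ^ n)"
      unfolding err_def by (rule sum_norm_le)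
    also have "\<dots> = real (n - 1) * (A * B * norm x ^ n)" by simp
    also have "\<dots> \<le> real n * (A * B * norm x ^ n)"
    proof -
      have "0 \<le> A" "0 \<le> B" using order_trans[OF norm_ge_zero A] order_trans[OF norm_ge_zero B] .
      thus ?thesis by (intro mult_right_mono) auto
    qed
    finally show ?thesis by (simp add: mult_ac)
  qed
  moreover have "(\<lambda>n. A * B * (real n * norm x ^ n)) \<longlonglongrightarrow> 0"
    using powser_times_n_limit_0[of "norm x"] x by (intro tendsto_mult_right_zero) auto
  ultimately have err: "err \<longlonglongrightarrow> 0"
    by (intro Lim_null_comparison[of err "\<lambda>n. A * B * (real n * norm x ^ n)"]) auto
  \<comment> \<open>This fails at \<open>n = 0\<close>, where the left side is empty but
    \<open>P 0 = 1\<close>.\<close>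
  have partial: "(\<Sum>s<2*n. x ^ (Suc s choose 2)) = P n + err n" if "n > 0" for n
  proof -
    have "{..<n} = insert 0 {1..<n}" using that by auto
    thus ?thesis
      using one_minus_power_nonzero[OF x]
      by (subst shanks_identity) (auto simp: err_def P_def gauss_prod_def)
  qed
  have "(\<lambda>n. P n + err n) \<longlonglongrightarrow> L + 0"
    by (intro tendsto_add P err)
  hence "(\<lambda>n. \<Sum>s<2*n. x ^ (Suc s choose 2)) \<longlonglongrightarrow> L + 0"
    by (rule Lim_transform_eventually)
       (auto intro!: eventually_mono[OF eventually_gt_at_top[of 0]] simp: partial)
  \<comment> \<open>Shanks' identity covers only even partial sums; summability makes this
    subsequence suffice.\<close>
  moreover have "(\<lambda>n. \<Sum>s<2*n. x ^ (Suc s choose 2)) \<longlonglongrightarrow> (\<Sum>s. x ^ (Suc s choose 2))"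
    using LIMSEQ_subseq_LIMSEQ[OF summable_LIMSEQ[OF summable_triangular[OF x]], of "\<lambda>n. 2 * n"]
    by (simp add: strict_mono_def o_def)
  ultimately show ?thesis
    using LIMSEQ_unique unfolding L_def by fastforce
qed

section \<open>The three identities\<close>

theorem theorem1p3:
  fixes q :: complex
  assumes "norm q < 1"
  shows "(summable (R_term q 2 1 1 1 2 2) \<and>
           R q 2 1 1 1 2 2 = qpoch_inf (- q) (q ^ 2)) \<and>
         (summable (R_term q 2 2 1 1 2 2) \<and>
           R q 2 2 1 1 2 2 = qpoch_inf (- (q ^ 2)) (q ^ 2)) \<and>
         (\<forall>m::nat. m \<ge> 1 \<longrightarrow>
           summable (R_term q (int m) (int m) 1 1 1 2) \<and>
           R q (int m) (int m) 1 1 1 2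
             = qpoch_inf (q ^ (2 * m)) (q ^ (2 * m)) / qpoch_inf (q ^ m) (q ^ (2 * m)))"
proof -
  have q2: "norm (q ^ 2) < 1"
    using assms by (simp add: norm_power power_less_one_iff)
  \<comment> \<open>The values \<open>t = 1\<close> and \<open>t = 2\<close> give the first two
    identities.\<close>
  have euler: "R_term q 2 (int t) 1 1 2 2 = euler_coeff (q ^ 2) (q ^ t)" for t
  proof
    fix n
    have "2 * int (n choose 2) + int t * int n = int (2 * (n choose 2) + t * n)" by simp
    thus "R_term q 2 (int t) 1 1 2 2 n = euler_coeff (q ^ 2) (q ^ t) n"
      by (simp only: R_term_def r_2_eq[OF assms] euler_coeff_def power_int_of_nat
            power_add power_mult) simp
  qed
  \<comment> \<open>With \<open>s = t = m\<close> the exponent is \<open>m\<close> times a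
    triangular number, so Gauss' identity applies at \<open>q ^ m\<close>.\<close>
  have gauss: "R_term q (int m) (int m) 1 1 1 2 = (\<lambda>n. (q ^ m) ^ (Suc n choose 2))" for m
  proof
    fix n
    have "int m * int (n choose 2) + int m * int n = int (m * (Suc n choose 2))"
      by (simp add: Suc_choose_two algebra_simps)
    thus "R_term q (int m) (int m) 1 1 1 2 n = (q ^ m) ^ (Suc n choose 2)"
      by (simp only: R_term_def r_1_eq[OF assms] power_int_of_nat power_mult mult_1_right)
  qed
  have "summable (R_term q (int m) (int m) 1 1 1 2) \<and>
          R q (int m) (int m) 1 1 1 2
            = qpoch_inf (q ^ (2 * m)) (q ^ (2 * m)) / qpoch_inf (q ^ m) (q ^ (2 * m))"
    if "m \<ge> 1" for m
  proof -
    have qm: "norm (q ^ m) < 1"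
      using assms that by (simp add: norm_power power_less_one_iff)
    have "q ^ (2 * m) = (q ^ m) ^ 2"
      by (simp add: mult.commute flip: power_mult)
    thus ?thesis
      using summable_triangular[OF qm] gauss_triangular[OF qm] by (simp add: R_def gauss)
  qed
  thus ?thesis
    using summable_euler_coeff[OF q2] euler_sum[OF q2] euler[of 1] euler[of 2]
    by (simp add: R_def)
qed

end
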